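(* Let $Y$ be a real random variable with Lebesgue density $f : \mathbb{R} \to [0,\infty)$, and let $G(x) := \mathbb{P}(U \le x)$, $0 \le x \le 1$, be the c.d.f. of $U := Y - \lfloor Y \rfloor$. Suppose that $\mathrm{TV}(f) < \infty$. Then for $0 \le x < y \le 1$, $$\bigl| G(y) - G(x) - (y-x) \bigr| \le (y-x)\bigl(1-(y-x)\bigr)\, \mathrm{TV}(f)/2 .$$ In particular, $$\mathrm{KD}(G) \le \mathrm{TV}(f)/8 \quad\text{and}\quad \mathrm{MRAE}(G) \le \mathrm{TV}(f)/2 .$$
   Context: For a function $h : \mathbb{R} \to \mathbb{R}$, the total variation is $$\mathrm{TV}(h) := \sup\Bigl\{ \sum_{i=1}^m |h(t_i) - h(t_{i-1})| : m \in \mathbb{N};\ t_0 < t_1 < \cdots < t_m \text{ in } \mathbb{R} \Bigr\}.$$ The Kuiper distance between the distribution of $U$ and the uniform distribution on $[0,1)$ is $\mathrm{KD}(G) := \sup_{0 \le x < y \le 1} |G(y) - G(x) - (y-x)|$, and the maximal relative approximation error is $\mathrm{MRAE}(G) := \sup_{0 \le x < y \le 1} \bigl| \frac{G(y)-G(x)}{y-x} - 1 \bigr|$. *)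

theory Defs
  imports "HOL-Probability.Probability"
begin

text \<open>
  The suprema are taken in \<^typ>\<open>ereal\<close>, so that they are meaningful (possibly infinite) without
  a boundedness assumption.
\<close>

definition TV :: "(real \<Rightarrow> real) \<Rightarrow> ereal" where
  "TV h = (SUP (m, t) \<in> {(m :: nat, t :: nat \<Rightarrow> real). strict_mono_on {0..m} t}.
             ereal (\<Sum>i=1..m. \<bar>h (t i) - h (t (i - 1))\<bar>))"

definition KD :: "(real \<Rightarrow> real) \<Rightarrow> ereal" where
  "KD G = (SUP (x, y) \<in> {(x, y). 0 \<le> x \<and> x < y \<and> y \<le> 1}. ereal \<bar>G y - G x - (y - x)\<bar>)"

definition MRAE :: "(real \<Rightarrow> real) \<Rightarrow> ereal" where
  "MRAE G = (SUP (x, y) \<in> {(x, y). 0 \<le> x \<and> x < y \<and> y \<le> 1}. ereal \<bar>(G y - G x) / (y - x) - 1\<bar>)"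

end

theory Submission
  imports Defs
begin

text \<open>
  Let \<^term>\<open>F\<close> be the 1-periodic function with \<open>F u\<close> the sum of \<open>f (u + k)\<close> over the integers \<open>k\<close>;
  on \<open>[0,1)\<close> it is a density of \<open>U\<close>. For \<open>u < v < u + 1\<close> the points \<open>v + k - 1 < u + k < v + k\<close>
  interlace, and adding up the increments of \<open>f\<close> along them shows
  \<open>2 * F u \<le> 2 * F v + TV f\<close>, so \<open>F\<close> oscillates by at most \<open>TV f / 2\<close>.
  Put \<open>B = (x,y] \<inter> [0,1)\<close>, \<open>B' = [0,1) - B\<close> and \<open>d = y - x\<close>. Integrating
  \<open>F u \<le> F v + TV f / 2\<close> over \<open>B \<times> B'\<close> and over \<open>B' \<times> B\<close> bounds
  \<open>(1 - d) * P(U \<in> B) - d * P(U \<in> B') = P(U \<in> B) - d\<close> on both sides.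
\<close>

section \<open>Total variation along interlacing points\<close>

lemma sum_abs_diff_le_TV:
  fixes t :: "nat \<Rightarrow> real" and m :: nat
  assumes "strict_mono_on {0..m} t"
  shows "ereal (\<Sum>i=1..m. \<bar>h (t i) - h (t (i - 1))\<bar>) \<le> TV h"
  unfolding TV_def using assms by (intro SUP_upper2[where i = "(m, t)"]) auto

lemma TV_nonneg: "0 \<le> TV h"
proof -
  \<comment> \<open>The one-point partition \<open>m = 0\<close> contributes the empty sum, so the
    supremum is at least 0.\<close>
  have "strict_mono_on {0..0} real"
    by (rule strict_mono_onI) simp
  from sum_abs_diff_le_TV[OF this, of h] show ?thesis
    by (simp add: zero_ereal_def)
qed

text \<open>The sequence \<open>v - 1, u, v, u + 1, v + 1, ...\<close>. It starts at
  \<open>v - 1\<close> so that, among the indices up to \<open>2 * n\<close>, every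
  \<open>u + j\<close> with \<open>j < n\<close> is an inner point with neighbours on both
  sides.\<close>

definition interlace :: "real \<Rightarrow> real \<Rightarrow> nat \<Rightarrow> real" where
  "interlace u v i = (if even i then v + real (i div 2) - 1 else u + real (i div 2))"

lemma strict_mono_interlace:
  assumes "u < v" "v < u + 1"
  shows "strict_mono (interlace u v)"
  using assms by (auto simp: strict_mono_Suc_iff interlace_def)

lemma sum_increments_interlace:
  "(\<Sum>i=1..2*n. \<bar>f (interlace u v i) - f (interlace u v (i - 1))\<bar>) =
   (\<Sum>j<n. \<bar>f (u + real j) - f (v + real j - 1)\<bar> + \<bar>f (v + real j) - f (u + real j)\<bar>)"
proof (induction n)
  case (Suc n)
  have "2 * Suc n = Suc (Suc (2 * n))" by simp
  then show ?case
    using Suc by (simp add: interlace_def add_ac)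
qed simp

lemma interlaced_sum_le:
  assumes "u < v" "v < u + 1" "TV f \<le> ereal \<tau>"
  shows "2 * (\<Sum>j<n. f (u + real j)) \<le> (\<Sum>j<n. f (v + real j)) + (\<Sum>j<n. f (v + real j - 1)) + \<tau>"
proof -
  have "strict_mono_on {0..2*n} (interlace u v)"
    using strict_mono_interlace[OF assms(1,2)] by (auto simp: strict_mono_def strict_mono_on_def)
  from order_trans[OF sum_abs_diff_le_TV[OF this, of f] assms(3)]
  have "(\<Sum>j<n. \<bar>f (u + real j) - f (v + real j - 1)\<bar> + \<bar>f (v + real j) - f (u + real j)\<bar>) \<le> \<tau>"
    unfolding sum_increments_interlace by simp
  \<comment> \<open>The signs are chosen so that \<open>f (u + j)\<close> enters positively in both
    adjacent increments; this produces the factor 2.\<close>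
  moreover have "(\<Sum>j<n. (f (u + real j) - f (v + real j - 1)) + (f (u + real j) - f (v + real j))) \<le>
     (\<Sum>j<n. \<bar>f (u + real j) - f (v + real j - 1)\<bar> + \<bar>f (v + real j) - f (u + real j)\<bar>)"
    by (intro sum_mono) linarith
  moreover have "(\<Sum>j<n. (f (u + real j) - f (v + real j - 1)) + (f (u + real j) - f (v + real j))) =
     2 * (\<Sum>j<n. f (u + real j)) - ((\<Sum>j<n. f (v + real j)) + (\<Sum>j<n. f (v + real j - 1)))"
    unfolding sum.distrib sum_subtractf by simp
  ultimately show ?thesis
    by linarith
qed

section \<open>The periodized density and its oscillation\<close>

definition periodization :: "(real \<Rightarrow> real) \<Rightarrow> real \<Rightarrow> ennreal" where
  "periodization f u = (\<Sum>n. ennreal (f (u + of_int (int_decode n))))"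

lemma borel_measurable_periodization [measurable]:
  assumes [measurable]: "f \<in> borel_measurable borel"
  shows "periodization f \<in> borel_measurable borel"
  unfolding periodization_def by measurable

lemma sum_le_periodization:
  assumes "finite S" "\<And>t. 0 \<le> f t"
  shows "ennreal (\<Sum>k\<in>S. f (u + of_int k)) \<le> periodization f u"
proof -
  have "ennreal (\<Sum>k\<in>S. f (u + of_int k)) = (\<Sum>k\<in>S. ennreal (f (u + of_int k)))"
    using assms by (simp add: sum_ennreal)
  also have "\<dots> = (\<Sum>n\<in>int_encode ` S. ennreal (f (u + of_int (int_decode n))))"
    by (subst sum.reindex) (auto intro: inj_on_subset[OF inj_int_encode])
  also have "\<dots> \<le> periodization f u"
    unfolding periodization_def using assms(1) by (intro sum_le_suminf) auto
  finally show ?thesis .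
qed

text \<open>Any finite set of integers lies in a block \<open>-K..K\<close> and the terms are
  nonnegative, so bounds over blocks of consecutive integers suffice. Such blocks are what the
  interlacing inequality controls.\<close>

lemma periodization_leI:
  assumes "\<And>t. 0 \<le> f t" "\<And>a n. ennreal (\<Sum>j<n. f (u + of_int a + real j)) \<le> C"
  shows "periodization f u \<le> C"
  unfolding periodization_def
proof (intro suminf_le_const)
  fix N
  \<comment> \<open>Inserting 0 keeps the set nonempty when \<open>N = 0\<close>.\<close>
  define K where "K = Max (insert 0 ((\<lambda>n. \<bar>int_decode n\<bar>) ` {..<N}))"
  have K: "\<bar>int_decode n\<bar> \<le> K" if "n < N" for n
    unfolding K_def using that by (intro Max_ge) auto
  have inj: "inj_on int_decode {..<N}"
    by (rule inj_on_subset[OF inj_int_decode]) auto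
  have "(\<Sum>n<N. ennreal (f (u + of_int (int_decode n)))) = ennreal (\<Sum>k\<in>int_decode ` {..<N}. f (u + of_int k))"
    using assms(1) by (subst sum.reindex[OF inj]) (simp add: sum_ennreal)
  also have "\<dots> \<le> ennreal (\<Sum>k\<in>(\<lambda>j. - K + int j) ` {..<nat (2*K+1)}. f (u + of_int k))"
  proof (intro ennreal_leI sum_mono2)
    show "int_decode ` {..<N} \<subseteq> (\<lambda>j. - K + int j) ` {..<nat (2*K+1)}"
    proof clarify
      fix n assume "n < N"
      with K[of n] show "int_decode n \<in> (\<lambda>j. - K + int j) ` {..<nat (2*K+1)}"
        by (intro image_eqI[of _ _ "nat (int_decode n + K)"]) auto
    qed
  qed (use assms(1) in auto)
  also have "\<dots> = ennreal (\<Sum>j<nat (2*K+1). f (u + of_int (- K) + real j))"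
    by (subst sum.reindex) (auto simp: inj_on_def algebra_simps)
  also have "\<dots> \<le> C" by (rule assms(2))
  finally show "(\<Sum>n<N. ennreal (f (u + of_int (int_decode n)))) \<le> C" .
qed simp

lemma periodization_le:
  assumes f: "\<And>t. 0 \<le> f t" and \<tau>: "TV f \<le> ereal \<tau>" "0 \<le> \<tau>"
    and u: "0 \<le> u" "u < 1" and v: "0 \<le> v" "v < 1"
  shows "periodization f u \<le> periodization f v + ennreal (\<tau> / 2)"
proof (cases "u = v")
  case False
  \<comment> \<open>Interlacing needs a translate of \<open>v\<close> in the open interval from
    \<open>u\<close> to \<open>u + 1\<close>: the shift is 0 or 1, according to the order of
    \<open>u\<close> and \<open>v\<close>.\<close>
  obtain b :: int where b: "u < v + of_int b" "v + of_int b < u + 1"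
  proof (cases "u < v")
    case True
    with u v that[of 0] show ?thesis by simp
  next
    case less: False
    with False u v that[of 1] show ?thesis by simp
  qed
  have shifted: "ennreal (\<Sum>j<n. f (v + of_int c + real j)) \<le> periodization f v" for c :: int and n
  proof -
    have "(\<Sum>j<n. f (v + of_int c + real j)) = (\<Sum>k\<in>(\<lambda>j. c + int j) ` {..<n}. f (v + of_int k))"
      by (subst sum.reindex) (auto simp: inj_on_def algebra_simps)
    then show ?thesis
      using sum_le_periodization[of "(\<lambda>j. c + int j) ` {..<n}" f v] f by simp
  qed
  show ?thesis
  proof (rule periodization_leI[OF f])
    fix a :: int and n
    \<comment> \<open>Both \<open>w\<close> and \<open>w - 1\<close> are integer translates of
      \<open>v\<close>, so the block sums starting at either point are at most
      \<open>periodization f v\<close>.\<close>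
    define w where "w = v + of_int b + of_int a"
    have w: "w = v + of_int (b + a)" "w - 1 = v + of_int (b + a - 1)"
      by (simp_all add: w_def)
    let ?S = "\<lambda>z. \<Sum>j<n. f (z + real j)"
    have "2 * ?S (u + of_int a) \<le> ?S w + (\<Sum>j<n. f (w + real j - 1)) + \<tau>"
      using b by (intro interlaced_sum_le \<tau>) (auto simp: w_def)
    also have "(\<Sum>j<n. f (w + real j - 1)) = ?S (w - 1)"
      by (simp add: algebra_simps)
    \<comment> \<open>Halving leaves the average of the two block sums, which is at most their
      maximum.\<close>
    finally have "?S (u + of_int a) \<le> max (?S w) (?S (w - 1)) + \<tau> / 2"
      by linarith
    then have "ennreal (?S (u + of_int a)) \<le> ennreal (max (?S w) (?S (w - 1)) + \<tau> / 2)"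
      by (rule ennreal_leI)
    also have "\<dots> = ennreal (max (?S w) (?S (w - 1))) + ennreal (\<tau> / 2)"
      using \<tau>(2) f by (intro ennreal_plus) (auto simp: le_max_iff_disj intro: sum_nonneg)
    also have "ennreal (max (?S w) (?S (w - 1))) \<le> periodization f v"
      using shifted[of "b + a" n, folded w(1)] shifted[of "b + a - 1" n, folded w(2)]
      by (simp add: max_def)
    finally show "ennreal (?S (u + of_int a)) \<le> periodization f v + ennreal (\<tau> / 2)"
      by (simp add: add_right_mono)
  qed
qed simp

section \<open>Integrals of the periodization as integrals over the fractional part\<close>

lemma suminf_indicator_frac:
  assumes "B \<subseteq> {0..<1}"
  shows "(\<Sum>n. indicator B (t - of_int (int_decode n)) :: ennreal) = indicator B (frac t)"
proof -
  \<comment> \<open>Only the integer \<open>\<lfloor>t\<rfloor>\<close> translates \<open>t\<close>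
    into \<open>[0,1)\<close>, so the series has at most one nonzero term.\<close>
  have "indicator B (t - of_int (int_decode n)) = (0 :: ennreal)" if "n \<noteq> int_encode \<lfloor>t\<rfloor>" for n
  proof -
    have "int_decode n \<noteq> \<lfloor>t\<rfloor>"
      using that by (metis int_decode_inverse)
    then have "t - of_int (int_decode n) \<notin> {0..<1}"
      by (auto simp: floor_unique)
    with assms show ?thesis
      by (auto simp: indicator_def)
  qed
  then have "(\<Sum>n. indicator B (t - of_int (int_decode n)) :: ennreal) =
      (\<Sum>n\<in>{int_encode \<lfloor>t\<rfloor>}. indicator B (t - of_int (int_decode n)))"
    by (intro suminf_finite) auto
  then show ?thesis
    by (simp add: frac_def)
qed

lemma nn_integral_periodization:
  assumes [measurable]: "f \<in> borel_measurable borel" "B \<in> sets borel" and B: "B \<subseteq> {0..<1}"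
  shows "(\<integral>\<^sup>+u. periodization f u * indicator B u \<partial>lborel) =
         (\<integral>\<^sup>+t. ennreal (f t) * indicator B (frac t) \<partial>lborel)"
proof -
  have "(\<integral>\<^sup>+u. periodization f u * indicator B u \<partial>lborel) =
      (\<Sum>n. \<integral>\<^sup>+u. ennreal (f (u + of_int (int_decode n))) * indicator B u \<partial>lborel)"
    unfolding periodization_def ennreal_suminf_multc[symmetric] by (intro nn_integral_suminf) measurable
  also have "\<dots> = (\<Sum>n. \<integral>\<^sup>+t. ennreal (f t) * indicator B (t - of_int (int_decode n)) \<partial>lborel)"
  proof (intro suminf_cong)
    fix n
    show "(\<integral>\<^sup>+u. ennreal (f (u + of_int (int_decode n))) * indicator B u \<partial>lborel) =
       (\<integral>\<^sup>+t. ennreal (f t) * indicator B (t - of_int (int_decode n)) \<partial>lborel)"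
      \<comment> \<open>Translation invariance, applied to the right-hand integral.\<close>
      by (subst (2) nn_integral_real_affine[where c = 1 and t = "of_int (int_decode n)"])
         (auto simp: add.commute)
  qed
  also have "\<dots> = (\<integral>\<^sup>+t. (\<Sum>n. ennreal (f t) * indicator B (t - of_int (int_decode n))) \<partial>lborel)"
    by (intro nn_integral_suminf[symmetric]) measurable
  finally show ?thesis
    by (simp add: suminf_indicator_frac[OF B])
qed

section \<open>Averaging the oscillation bound over a pair of sets\<close>

lemma nn_integral_cross_le:
  fixes F :: "'a \<Rightarrow> ennreal"
  assumes [measurable]: "F \<in> borel_measurable M" "A \<in> sets M" "B \<in> sets M"
    and le: "\<And>u v. u \<in> A \<Longrightarrow> v \<in> B \<Longrightarrow> F u \<le> F v + T"
  shows "emeasure M B * (\<integral>\<^sup>+u. F u * indicator A u \<partial>M) \<le>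
         emeasure M A * (\<integral>\<^sup>+v. F v * indicator B v \<partial>M) + emeasure M A * emeasure M B * T"
proof -
  let ?I = "\<integral>\<^sup>+u. F u * indicator A u \<partial>M"
  \<comment> \<open>First integration, in \<open>u\<close> over \<open>A\<close> with
    \<open>v\<close> fixed; the integration in \<open>v\<close> over \<open>B\<close>
    follows.\<close>
  have bound: "?I * indicator B v \<le> emeasure M A * (F v * indicator B v) + emeasure M A * T * indicator B v" for v
  proof (cases "v \<in> B")
    case True
    have "?I \<le> (\<integral>\<^sup>+u. (F v + T) * indicator A u \<partial>M)"
      using True le by (intro nn_integral_mono) (auto simp: indicator_def)
    also have "\<dots> = emeasure M A * F v + emeasure M A * T"
      by (subst nn_integral_cmult_indicator) (simp_all add: algebra_simps)
    finally show ?thesis using True by simp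
  qed simp
  have "emeasure M B * ?I = (\<integral>\<^sup>+v. ?I * indicator B v \<partial>M)"
    by (subst nn_integral_cmult_indicator) (simp_all add: mult.commute)
  also have "\<dots> \<le> (\<integral>\<^sup>+v. emeasure M A * (F v * indicator B v) + emeasure M A * T * indicator B v \<partial>M)"
    by (intro nn_integral_mono bound)
  also have "\<dots> = emeasure M A * (\<integral>\<^sup>+v. F v * indicator B v \<partial>M) + emeasure M A * T * emeasure M B"
    by (simp add: nn_integral_add nn_integral_cmult nn_integral_cmult_indicator)
  finally show ?thesis
    by (simp add: mult_ac)
qed

lemma prob_frac_diff_le:
  assumes "prob_space M" and f: "\<And>t. 0 \<le> f t"
    and Y: "distributed M lborel Y (\<lambda>t. ennreal (f t))"
    and \<tau>: "TV f \<le> ereal \<tau>" "0 \<le> \<tau>"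
    and xy: "0 \<le> x" "x < y" "y \<le> 1"
  shows "\<bar>measure M {\<omega> \<in> space M. frac (Y \<omega>) \<le> y} - measure M {\<omega> \<in> space M. frac (Y \<omega>) \<le> x} - (y - x)\<bar>
         \<le> (y - x) * (1 - (y - x)) * \<tau> / 2"
proof -
  interpret prob_space M by fact
  have [measurable]: "Y \<in> borel_measurable M"
    using distributed_measurable[OF Y] by simp
  have "(\<lambda>t. ennreal (f t)) \<in> borel_measurable borel"
    using distributed_borel_measurable[OF Y] by simp
  \<comment> \<open>The density is known to be measurable only as an \<open>ennreal\<close>
    function; nonnegativity of \<open>f\<close> allows going back.\<close>
  then have "(\<lambda>t. enn2real (ennreal (f t))) \<in> borel_measurable borel"
    by measurable
  then have [measurable]: "f \<in> borel_measurable borel"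
    using f by simp
  have [measurable]: "(frac :: real \<Rightarrow> real) \<in> borel_measurable borel"
    unfolding frac_def by measurable
  define P where "P B = measure M {\<omega> \<in> space M. frac (Y \<omega>) \<in> B}" for B
  have P: "(\<integral>\<^sup>+u. periodization f u * indicator B u \<partial>lborel) = ennreal (P B)"
    if [measurable]: "B \<in> sets borel" and B: "B \<subseteq> {0..<1}" for B
  proof -
    have meas: "{t. frac t \<in> B} \<in> sets borel"
      by measurable
    have "Y -` {t. frac t \<in> B} \<inter> space M = {\<omega> \<in> space M. frac (Y \<omega>) \<in> B}"
      by auto
    then have "ennreal (P B) = (\<integral>\<^sup>+t. ennreal (f t) * indicator {t. frac t \<in> B} t \<partial>lborel)"
      using distributed_emeasure[OF Y, of "{t. frac t \<in> B}"] meas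
      by (simp add: P_def emeasure_eq_measure)
    also have "\<dots> = (\<integral>\<^sup>+t. ennreal (f t) * indicator B (frac t) \<partial>lborel)"
      by (simp add: indicator_def)
    finally show ?thesis
      using nn_integral_periodization[of f B] B by simp
  qed
  define d where "d = y - x"
  have d: "0 < d" "d \<le> 1"
    using xy by (auto simp: d_def)
  \<comment> \<open>The intersection removes only the point 1, when \<open>y = 1\<close>. This
    changes neither the length nor the event, as \<open>frac\<close> never equals 1.\<close>
  define B where "B = {x<..y} \<inter> {0..<1}"
  define B' where "B' = {0..<1} - B"
  have [measurable]: "B \<in> sets borel" "B' \<in> sets borel"
    by (auto simp: B_def B'_def)
  have sub: "B \<subseteq> {0..<1}" "B' \<subseteq> {0..<1}"
    by (auto simp: B_def B'_def)
  have "B = (if y = 1 then {x<..<y} else {x<..y})"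
    using xy by (auto simp: B_def)
  then have eB: "emeasure lborel B = ennreal d"
    using xy by (auto simp: d_def)
  have eB': "emeasure lborel B' = ennreal (1 - d)"
    unfolding B'_def using sub eB d by (subst emeasure_Diff) (auto simp: ennreal_minus simp flip: ennreal_1)
  have PB: "P B = measure M {\<omega> \<in> space M. frac (Y \<omega>) \<le> y} - measure M {\<omega> \<in> space M. frac (Y \<omega>) \<le> x}"
  proof -
    have "{\<omega> \<in> space M. frac (Y \<omega>) \<in> B} =
        {\<omega> \<in> space M. frac (Y \<omega>) \<le> y} - {\<omega> \<in> space M. frac (Y \<omega>) \<le> x}"
      using xy by (auto simp: B_def frac_lt_1)
    then show ?thesis
      unfolding P_def using xy by (simp only:) (rule finite_measure_Diff, measurable, force)
  qed
  have PB': "P B' = 1 - P B"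
  proof -
    have "{\<omega> \<in> space M. frac (Y \<omega>) \<in> B'} = space M - {\<omega> \<in> space M. frac (Y \<omega>) \<in> B}"
      by (auto simp: B'_def frac_lt_1)
    then show ?thesis
      unfolding P_def by (simp add: prob_compl)
  qed
  have P_nonneg: "0 \<le> P C" for C
    by (simp add: P_def)
  \<comment> \<open>Stated for a general pair so that \<open>(B, B')\<close> gives the upper and
    \<open>(B', B)\<close> the lower bound.\<close>
  have le: "e' * P C \<le> e * P C' + e * e' * (\<tau> / 2)"
    if [measurable]: "C \<in> sets borel" "C' \<in> sets borel" and C: "C \<subseteq> {0..<1}" "C' \<subseteq> {0..<1}"
      and e: "emeasure lborel C = ennreal e" "emeasure lborel C' = ennreal e'" "0 \<le> e" "0 \<le> e'"
    for C C' e e'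
  proof -
    have "ennreal e' * ennreal (P C) \<le> ennreal e * ennreal (P C') + ennreal e * ennreal e' * ennreal (\<tau> / 2)"
      using nn_integral_cross_le[of "periodization f" lborel C C' "ennreal (\<tau> / 2)",
          OF _ _ _ periodization_le[OF f \<tau>]] C
      by (simp add: P e subset_iff)
    also have "\<dots> = ennreal (e * P C' + e * e' * (\<tau> / 2))"
      using e \<tau>(2) P_nonneg by (simp only: ennreal_mult ennreal_plus mult_nonneg_nonneg divide_nonneg_nonneg zero_le_numeral)
    finally have "ennreal (e' * P C) \<le> ennreal (e * P C' + e * e' * (\<tau> / 2))"
      using e P_nonneg by (simp only: ennreal_mult)
    moreover have "0 \<le> e * P C' + e * e' * (\<tau> / 2)"
      using e \<tau>(2) P_nonneg by simp
    ultimately show ?thesis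
      by (simp only: ennreal_le_iff)
  qed
  have "(1 - d) * P B \<le> d * P B' + d * (1 - d) * (\<tau> / 2)"
    using d sub eB eB' by (intro le) auto
  moreover have "d * P B' \<le> (1 - d) * P B + (1 - d) * d * (\<tau> / 2)"
    using d sub eB eB' by (intro le) auto
  ultimately have "\<bar>P B - d\<bar> \<le> d * (1 - d) * \<tau> / 2"
    unfolding PB' abs_le_iff by (simp add: field_simps)
  then show ?thesis
    by (simp add: PB d_def)
qed

theorem corollary2:
  fixes M :: "'a measure" and Y U :: "'a \<Rightarrow> real" and f G :: "real \<Rightarrow> real"
  assumes "prob_space M"
    and "\<And>t. 0 \<le> f t"
    and "distributed M lborel Y (\<lambda>t. ennreal (f t))"
    and "\<And>\<omega>. U \<omega> = Y \<omega> - of_int \<lfloor>Y \<omega>\<rfloor>"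
    and "\<And>x. 0 \<le> x \<Longrightarrow> x \<le> 1 \<Longrightarrow> G x = measure M {\<omega> \<in> space M. U \<omega> \<le> x}"
    and "TV f < \<infinity>"
  shows "(\<forall>x y. 0 \<le> x \<and> x < y \<and> y \<le> 1 \<longrightarrow>
            ereal \<bar>G y - G x - (y - x)\<bar> \<le> ereal ((y - x) * (1 - (y - x))) * TV f / 2)
         \<and> KD G \<le> TV f / 8
         \<and> MRAE G \<le> TV f / 2"
proof -
  have "TV f \<noteq> - \<infinity>"
    using TV_nonneg[of f] by auto
  with assms(6) obtain \<tau> where \<tau>: "TV f = ereal \<tau>"
    by (cases "TV f") auto
  have \<tau>0: "0 \<le> \<tau>"
    using TV_nonneg[of f] \<tau> by simp
  have U: "U \<omega> = frac (Y \<omega>)" for \<omega>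
    using assms(4) by (simp add: frac_def)
  have main: "\<bar>G y - G x - (y - x)\<bar> \<le> (y - x) * (1 - (y - x)) * \<tau> / 2"
    if "0 \<le> x" "x < y" "y \<le> 1" for x y
    using prob_frac_diff_le[OF assms(1,2,3) _ \<tau>0 that] assms(5) that by (simp add: \<tau> U)
  have KD: "\<bar>G y - G x - (y - x)\<bar> \<le> \<tau> / 8" if "0 \<le> x" "x < y" "y \<le> 1" for x y
  proof -
    have "(y - x) * (1 - (y - x)) \<le> 1 / 4"
      \<comment> \<open>With \<open>s = y - x\<close>, the bound
        \<open>s * (1 - s) \<le> 1 / 4\<close> is \<open>(s - 1 / 2)^2 \<ge> 0\<close>; the maximum
        at \<open>s = 1 / 2\<close> gives the constant 1/8.\<close>
      using zero_le_power2[of "y - x - 1 / 2"] by (simp add: power2_eq_square algebra_simps)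
    from mult_right_mono[OF this \<tau>0] main[OF that] show ?thesis
      by simp
  qed
  have MRAE: "\<bar>(G y - G x) / (y - x) - 1\<bar> \<le> \<tau> / 2" if "0 \<le> x" "x < y" "y \<le> 1" for x y
  proof -
    have "\<bar>(G y - G x) / (y - x) - 1\<bar> = \<bar>G y - G x - (y - x)\<bar> / (y - x)"
    proof -
      have "(G y - G x) / (y - x) - 1 = (G y - G x - (y - x)) / (y - x)"
        using that by (simp add: diff_divide_distrib)
      then show ?thesis
        using that by (simp add: abs_divide)
    qed
    \<comment> \<open>Division cancels the factor \<open>y - x\<close> of the main bound; the
      remaining \<open>1 - (y - x)\<close> is below 1.\<close>
    also have "\<dots> \<le> (1 - (y - x)) * \<tau> / 2"
      using main[OF that] that by (simp add: divide_le_eq mult_ac)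
    also have "\<dots> \<le> 1 * \<tau> / 2"
      using that \<tau>0 by (intro divide_right_mono mult_right_mono) auto
    finally show ?thesis by simp
  qed
  show ?thesis
    unfolding KD_def MRAE_def \<tau>
    using main KD MRAE by (auto intro!: SUP_least)
qed

end
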